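(* Let $n\geqslant 2$ and let $E\subset\mathbb{R}^n$ be a closed set with $\mathrm{Int}\,E\neq\varnothing$. If $E$ is weakly $1$-convex (in the sense of closed sets), then the open set $\mathrm{Int}\,E$ is weakly $1$-convex (in the sense of open sets).
   Context: $\mathbb{R}^n$ carries the Euclidean norm; $\mathrm{Int}\,E$ is the interior of $E$. An open set $G\subset\mathbb{R}^n$ is called weakly $1$-convex if for every point $x\in\partial G$ there exists a straight line $L$ (a $1$-dimensional affine subspace) with $x\in L$ and $L\cap G=\varnothing$. A set $A$ is approximated from the outside by a family of open sets $A_k$, $k=1,2,\ldots$, if $\overline{A_{k+1}}\subset A_k$ for all $k$ and $A=\bigcap_k A_k$. A closed set $E\subset\mathbb{R}^n$ is called weakly $1$-convex if it can be approximated from the outside by a family of open weakly $1$-convex sets. *)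

theory Defs
  imports "HOL-Analysis.Analysis"
begin

definition straight_line :: "'a::euclidean_space set \<Rightarrow> bool" where
  "straight_line L \<longleftrightarrow> affine L \<and> aff_dim L = 1"

definition weakly_1_convex_open :: "'a::euclidean_space set \<Rightarrow> bool" where
  "weakly_1_convex_open G \<longleftrightarrow>
     open G \<and> (\<forall>x\<in>frontier G. \<exists>L. straight_line L \<and> x \<in> L \<and> L \<inter> G = {})"

(* The family is indexed by k = 1, 2, ...; the value A 0 is irrelevant. *)
definition approximated_from_outside ::
    "'a::euclidean_space set \<Rightarrow> (nat \<Rightarrow> 'a set) \<Rightarrow> bool" where
  "approximated_from_outside E A \<longleftrightarrow>
     (\<forall>k\<ge>1. open (A k)) \<and> (\<forall>k\<ge>1. closure (A (Suc k)) \<subseteq> A k) \<and> E = (\<Inter>k\<in>{1..}. A k)"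

definition weakly_1_convex_closed :: "'a::euclidean_space set \<Rightarrow> bool" where
  "weakly_1_convex_closed E \<longleftrightarrow>
     closed E \<and>
     (\<exists>A. approximated_from_outside E A \<and> (\<forall>k\<ge>1. weakly_1_convex_open (A k)))"

end

(* Points outside E close to a frontier point x of its interior lie outside some A k while x lies
   inside, so frontier points of suitable A k converge to x. The lines given there miss E; by
   compactness of the unit sphere a subsequence of their directions converges, and since the
   interior of E is open, the limit line through x cannot meet it. *)
theory Submission
  imports Defs
begin

text \<open>Affine dimension 1 rules out a singleton, so a second point \<open>a\<close> exists and
  \<open>a - z\<close> can be normalised. Unit directions turn a sequence of lines into a sequence
  on the compact sphere.\<close>

lemma straight_line_direction:
  fixes L :: "'a::euclidean_space set"
  assumes "straight_line L" "z \<in> L"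
  obtains d where "norm d = 1" "\<And>t. z + t *\<^sub>R d \<in> L"
proof -
  have "L \<noteq> {z}"
    using assms(1) unfolding straight_line_def by auto
  then obtain a where a: "a \<in> L" "a \<noteq> z"
    using assms(2) by blast
  show thesis
  proof
    show "norm (sgn (a - z)) = 1"
      using a by (simp add: norm_sgn)
    fix t
    \<comment> \<open>The weights sum to 1; dividing by \<open>norm (a - z)\<close> makes
      \<open>t\<close> the signed distance from \<open>z\<close>.\<close>
    have "(1 - t / norm (a - z)) *\<^sub>R z + (t / norm (a - z)) *\<^sub>R a \<in> L"
      using assms a by (intro mem_affine) (auto simp: straight_line_def)
    then show "z + t *\<^sub>R sgn (a - z) \<in> L"
      by (simp add: sgn_div_norm algebra_simps divide_inverse)
  qed
qed

lemma straight_line_affine_hull_2: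
  fixes a b :: "'a::euclidean_space"
  assumes "a \<noteq> b"
  shows "straight_line (affine hull {a, b})"
  using assms by (simp add: straight_line_def aff_dim_2)

text \<open>For each fixed parameter \<open>t\<close>, the point of the limit line is a limit of
  points on the given lines, all in the closed set \<open>- U\<close>.\<close>

lemma straight_line_limit:
  fixes z :: "nat \<Rightarrow> 'a::euclidean_space"
  assumes "z \<longlonglongrightarrow> x" "open U"
    and lines: "\<And>j. \<exists>L. straight_line L \<and> z j \<in> L \<and> L \<inter> U = {}"
  shows "\<exists>L. straight_line L \<and> x \<in> L \<and> L \<inter> U = {}"
proof -
  have "\<exists>d. norm d = 1 \<and> (\<forall>t. z j + t *\<^sub>R d \<notin> U)" for j
    using lines[of j] straight_line_direction[of _ "z j"] by (metis disjoint_iff)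
  then obtain d where d: "\<And>j. norm (d j) = 1" "\<And>j t. z j + t *\<^sub>R d j \<notin> U"
    by metis
  have "seq_compact (sphere (0::'a) 1)"
    by (simp add: compact_imp_seq_compact)
  then obtain e r where e: "e \<in> sphere 0 1" "strict_mono r" "(d \<circ> r) \<longlonglongrightarrow> e"
    using d(1) unfolding seq_compact_def by (metis mem_sphere_0)
  have avoid: "x + t *\<^sub>R e \<notin> U" for t
  proof -
    have "(\<lambda>j. z (r j) + t *\<^sub>R d (r j)) \<longlonglongrightarrow> x + t *\<^sub>R e"
      using LIMSEQ_subseq_LIMSEQ[OF assms(1) e(2)] e(3) unfolding comp_def
      by (intro tendsto_intros)
    with closed_sequentially[of "- U" "\<lambda>j. z (r j) + t *\<^sub>R d (r j)"] show ?thesis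
      using d(2) \<open>open U\<close> by (auto simp: closed_Compl)
  qed
  have "e \<noteq> 0"
    using e(1) by auto
  then have "straight_line (affine hull {x, x + e})"
    by (intro straight_line_affine_hull_2) simp
  moreover have "x \<in> affine hull {x, x + e}"
    by (simp add: hull_inc)
  moreover have "affine hull {x, x + e} \<inter> U = {}"
    using avoid unfolding affine_hull_2_alt by auto
  ultimately show ?thesis
    by blast
qed

text \<open>A short segment from \<open>x\<close> to a point outside \<open>E\<close> starts inside
  every \<open>A k\<close> and ends outside some \<open>A k\<close>; being connected, it crosses
  that frontier.\<close>

lemma approximated_from_outside_frontier_near:
  fixes E :: "'a::euclidean_space set"
  assumes "approximated_from_outside E A" "x \<in> E" "x \<notin> interior E" "\<epsilon> > 0"
  shows "\<exists>k\<ge>1. \<exists>z\<in>frontier (A k). dist x z < \<epsilon>"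
proof -
  obtain y where y: "dist x y < \<epsilon>" "y \<notin> E"
    using assms(3,4) unfolding mem_interior by (meson mem_ball subsetI)
  obtain k where k: "k \<ge> 1" "y \<notin> A k" "x \<in> A k"
    using y(2) assms(1,2) unfolding approximated_from_outside_def by auto
  have "closed_segment x y \<inter> frontier (A k) \<noteq> {}"
    using k by (intro connected_Int_frontier) auto
  then obtain z where z: "z \<in> closed_segment x y" "z \<in> frontier (A k)"
    by blast
  then have "dist x z < \<epsilon>"
    using dist_in_closed_segment[OF z(1)] y(1) by (simp add: dist_commute)
  with k z show ?thesis
    by blast
qed

theorem theorem4:
  fixes E :: "(real ^ 'n) set"
  assumes "CARD('n) \<ge> 2"
    and "closed E"
    and "interior E \<noteq> {}"
    and "weakly_1_convex_closed E"
  shows "weakly_1_convex_open (interior E)"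
  unfolding weakly_1_convex_open_def
proof (intro conjI ballI)
  fix x assume x: "x \<in> frontier (interior E)"
  \<comment> \<open>Closedness puts the closure of the interior inside \<open>E\<close>, and an open
    set misses its own frontier.\<close>
  then have "x \<in> E" "x \<notin> interior E"
    using closure_mono[OF interior_subset, of E] \<open>closed E\<close> by (auto simp: frontier_def)
  obtain A where A: "approximated_from_outside E A" "\<And>k. k \<ge> 1 \<Longrightarrow> weakly_1_convex_open (A k)"
    using assms(4) unfolding weakly_1_convex_closed_def by blast
  have "\<exists>k\<ge>1. \<exists>z\<in>frontier (A k). dist x z < inverse (real (Suc j))" for j
    using A(1) \<open>x \<in> E\<close> \<open>x \<notin> interior E\<close>
    by (intro approximated_from_outside_frontier_near) auto
  then obtain k z where kz: "\<And>j. k j \<ge> 1" "\<And>j. z j \<in> frontier (A (k j))"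
      "\<And>j. dist x (z j) < inverse (real (Suc j))"
    by metis
  show "\<exists>L. straight_line L \<and> x \<in> L \<and> L \<inter> interior E = {}"
  proof (rule straight_line_limit)
    show "z \<longlonglongrightarrow> x"
      using kz(3) by (intro metric_tendsto_imp_tendsto[OF LIMSEQ_inverse_real_of_nat])
        (auto simp: dist_commute less_imp_le)
    fix j
    \<comment> \<open>The index \<open>k j\<close> may vary with \<open>j\<close>, but a line
      missing \<open>A (k j)\<close> always misses the fixed open set
      \<open>interior E\<close>.\<close>
    have "interior E \<subseteq> A (k j)"
      using A(1) kz(1)[of j] interior_subset[of E] unfolding approximated_from_outside_def by auto
    then show "\<exists>L. straight_line L \<and> z j \<in> L \<and> L \<inter> interior E = {}"
      using A(2)[OF kz(1)[of j]] kz(2)[of j] unfolding weakly_1_convex_open_def by blast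
  qed simp
qed simp

end
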